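(* For $\varepsilon>0$ define $\mathcal{E}_\varepsilon(\boldsymbol\theta):=-\varepsilon\,\Phi_\varepsilon^G(\boldsymbol\theta)$. Then for every $\boldsymbol\theta\in\mathbb{R}^{K\times N}$ and every $\varepsilon>0$, \[ 0\le\mathcal{E}_\varepsilon(\boldsymbol\theta)-\mathcal{E}_0(\boldsymbol\theta)\le\varepsilon\log N, \] where the limit functional is \[ \mathcal{E}_0(\boldsymbol\theta):=\frac{1}{|\Omega|}\sum_{x\in\Omega}\Big(h_{\theta_{G(x)}}(x)-\min_{j\in[N]}h_{\theta_j}(x)\Big)\ \ge 0. \] In particular, $\mathcal{E}_\varepsilon\to\mathcal{E}_0$ uniformly on $\mathbb{R}^{K\times N}$ as $\varepsilon\to0$. Moreover, if perfect reconstruction of the given grain map $G$ is possible (i.e. if there exists $\boldsymbol\theta\in\mathbb{R}^{K\times N}$ such that $F_{\boldsymbol\theta}(x)=G(x)$ for all $x\in\Omega$), then $\min_{\mathbb{R}^{K\times N}}\mathcal{E}_0=0$.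
   Context: Let $\overline\Omega=[-1,1]^2$ and let $\Omega\subset\overline\Omega$ be a nonempty finite set (of pixels). Let $N>1$ and $K\ge 1$ be integers and $[N]:=\{1,\dots,N\}$. Let $G:\Omega\to[N]$ be a given map (the grain map) and $\eta:\overline\Omega\to\mathbb{R}^K$ a given function (the design function). For $\boldsymbol\theta=(\theta_1,\dots,\theta_N)\in\mathbb{R}^{K\times N}$ with $\theta_i\in\mathbb{R}^K$, set $h_{\theta_i}(x):=\theta_i\cdot\eta(x)$ for $x\in\overline\Omega$. Hard assignment: $F_{\boldsymbol\theta}(x):=\operatorname{arg\,min}_{i\in[N]}h_{\theta_i}(x)$, where if the minimiser is not unique the smallest minimising index is selected. Soft assignment, for $\varepsilon>0$: \[ (p_{\boldsymbol\theta}^\varepsilon)_i(x):=\frac{\exp\left(-\frac1\varepsilon h_{\theta_i}(x)\right)}{\sum_{j=1}^N\exp\left(-\frac1\varepsilon h_{\theta_j}(x)\right)},\qquad i\in[N]. \] Objective function, for $\varepsilon>0$: \[ \Phi_\varepsilon^G(\boldsymbol\theta):=\frac{1}{|\Omega|}\sum_{x\in\Omega}\log\big((p_{\boldsymbol\theta}^\varepsilon)_{G(x)}(x)\big). \] *)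

theory Defs
  imports "HOL-Analysis.Analysis"
begin

definition image_domain :: "(real \<times> real) set"
  where "image_domain = {-1..1} \<times> {-1..1}"

text \<open>The space of real \<open>K \<times> N\<close> parameter matrices: \<open>K\<close> is the cardinality of the index type
  \<open>'k\<close>, and the columns \<open>\<theta> 1, \<dots>, \<theta> N\<close> form an extensional function on \<open>{1..N}\<close>.\<close>

definition params :: "nat \<Rightarrow> (nat \<Rightarrow> real ^ 'k) set"
  where "params N = {1..N} \<rightarrow>\<^sub>E UNIV"

definition score :: "(real \<times> real \<Rightarrow> real ^ 'k) \<Rightarrow> real ^ 'k \<Rightarrow> real \<times> real \<Rightarrow> real"
  where "score \<eta> v x = inner v (\<eta> x)"

definition hard_assign ::
    "nat \<Rightarrow> (real \<times> real \<Rightarrow> real ^ 'k) \<Rightarrow> (nat \<Rightarrow> real ^ 'k) \<Rightarrow> real \<times> real \<Rightarrow> nat"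
  where "hard_assign N \<eta> \<theta> x =
    (LEAST i. is_arg_min (\<lambda>j. score \<eta> (\<theta> j) x) (\<lambda>j. j \<in> {1..N}) i)"

definition soft_assign ::
    "nat \<Rightarrow> (real \<times> real \<Rightarrow> real ^ 'k) \<Rightarrow> real \<Rightarrow> (nat \<Rightarrow> real ^ 'k) \<Rightarrow> nat \<Rightarrow> real \<times> real \<Rightarrow> real"
  where "soft_assign N \<eta> \<epsilon> \<theta> i x =
    exp (- (1 / \<epsilon>) * score \<eta> (\<theta> i) x) / (\<Sum>j\<in>{1..N}. exp (- (1 / \<epsilon>) * score \<eta> (\<theta> j) x))"

definition objective ::
    "(real \<times> real) set \<Rightarrow> nat \<Rightarrow> (real \<times> real \<Rightarrow> real ^ 'k) \<Rightarrow> (real \<times> real \<Rightarrow> nat)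
      \<Rightarrow> real \<Rightarrow> (nat \<Rightarrow> real ^ 'k) \<Rightarrow> real"
  where "objective \<Omega> N \<eta> G \<epsilon> \<theta> =
    1 / real (card \<Omega>) * (\<Sum>x\<in>\<Omega>. ln (soft_assign N \<eta> \<epsilon> \<theta> (G x) x))"

definition energy ::
    "(real \<times> real) set \<Rightarrow> nat \<Rightarrow> (real \<times> real \<Rightarrow> real ^ 'k) \<Rightarrow> (real \<times> real \<Rightarrow> nat)
      \<Rightarrow> real \<Rightarrow> (nat \<Rightarrow> real ^ 'k) \<Rightarrow> real"
  where "energy \<Omega> N \<eta> G \<epsilon> \<theta> = - \<epsilon> * objective \<Omega> N \<eta> G \<epsilon> \<theta>"

definition limit_energy ::
    "(real \<times> real) set \<Rightarrow> nat \<Rightarrow> (real \<times> real \<Rightarrow> real ^ 'k) \<Rightarrow> (real \<times> real \<Rightarrow> nat)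
      \<Rightarrow> (nat \<Rightarrow> real ^ 'k) \<Rightarrow> real"
  where "limit_energy \<Omega> N \<eta> G \<theta> =
    1 / real (card \<Omega>) *
      (\<Sum>x\<in>\<Omega>. score \<eta> (\<theta> (G x)) x - (MIN j\<in>{1..N}. score \<eta> (\<theta> j) x))"

end

theory Submission imports Defs begin

text \<open>The objective is an average of log-softmax values, and for a single pixel
  \<open>- \<epsilon> log p\<^sub>i = h\<^sub>i + \<epsilon> log (\<Sum>j. exp (- h\<^sub>j / \<epsilon>))\<close>.
  The second summand is a soft version of \<open>- min h\<close>: the sum of exponentials is at least its largest
  term, \<open>exp (- min h / \<epsilon>)\<close>, and at most \<open>N\<close> times that term (\<open>log_sum_exp_bounds\<close>). Replacing the
  soft by the hard minimum therefore changes each pixel's contribution by an amount in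
  \<open>[0, \<epsilon> log N]\<close>, and averaging over the pixels preserves these bounds (\<open>average_bounds\<close>). They do not
  depend on the parameters, so the convergence is uniform. The limit energy averages the
  nonnegative gaps \<open>h\<^sub>G - min h\<close>, and perfect reconstruction means that \<open>G\<close> selects a minimiser at
  every pixel, so that all gaps vanish.\<close>

text \<open>With \<open>m = Min (f ` A)\<close>, the index attaining \<open>m\<close> contributes \<open>exp (- m / \<epsilon>)\<close> to the sum,
  and no other index contributes more.\<close>

lemma log_sum_exp_bounds:
  fixes f :: "'a \<Rightarrow> real"
  assumes fin: "finite A" and ne: "A \<noteq> {}" and \<epsilon>: "\<epsilon> > 0"
  shows "0 \<le> Min (f ` A) + \<epsilon> * ln (\<Sum>j\<in>A. exp (- (1 / \<epsilon>) * f j))"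
    and "Min (f ` A) + \<epsilon> * ln (\<Sum>j\<in>A. exp (- (1 / \<epsilon>) * f j)) \<le> \<epsilon> * ln (real (card A))"
proof -
  define m where "m = Min (f ` A)"
  define S where "S = (\<Sum>j\<in>A. exp (- (1 / \<epsilon>) * f j))"
  have "m \<in> f ` A"
    unfolding m_def using fin ne by (intro Min_in) auto
  then obtain i where i: "i \<in> A" "f i = m"
    by auto
  have lower: "exp (- (1 / \<epsilon>) * m) \<le> S"
    unfolding S_def i(2)[symmetric]
    by (rule member_le_sum[OF i(1)]) (use fin in auto)
  then have S_pos: "S > 0"
    by (rule less_le_trans[OF exp_gt_zero])
  have "exp (- (1 / \<epsilon>) * f j) \<le> exp (- (1 / \<epsilon>) * m)" if "j \<in> A" for j
    using that fin \<epsilon> by (simp add: m_def divide_right_mono)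
  then have upper: "S \<le> real (card A) * exp (- (1 / \<epsilon>) * m)"
    unfolding S_def by (rule sum_bounded_above)
  have card_pos: "real (card A) > 0"
    using fin ne by (simp add: card_gt_0_iff)
  have "- (1 / \<epsilon>) * m \<le> ln S"
    using lower S_pos by (simp add: ln_ge_iff)
  then have "\<epsilon> * (- (1 / \<epsilon>) * m) \<le> \<epsilon> * ln S"
    using \<epsilon> by (intro mult_left_mono) auto
  then show "0 \<le> Min (f ` A) + \<epsilon> * ln (\<Sum>j\<in>A. exp (- (1 / \<epsilon>) * f j))"
    using \<epsilon> by (simp add: m_def S_def)
  have "ln S \<le> ln (real (card A) * exp (- (1 / \<epsilon>) * m))"
    using upper S_pos by (intro ln_mono) auto
  also have "\<dots> = ln (real (card A)) - (1 / \<epsilon>) * m"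
    using card_pos by (simp add: ln_mult)
  finally have "\<epsilon> * ln S \<le> \<epsilon> * (ln (real (card A)) - (1 / \<epsilon>) * m)"
    using \<epsilon> by (intro mult_left_mono) auto
  then show "Min (f ` A) + \<epsilon> * ln (\<Sum>j\<in>A. exp (- (1 / \<epsilon>) * f j)) \<le> \<epsilon> * ln (real (card A))"
    using \<epsilon> by (simp add: m_def S_def right_diff_distrib)
qed

lemma average_bounds:
  fixes g :: "'a \<Rightarrow> real"
  assumes "finite A" "A \<noteq> {}" and "\<And>x. x \<in> A \<Longrightarrow> a \<le> g x" and "\<And>x. x \<in> A \<Longrightarrow> g x \<le> b"
  shows "a \<le> 1 / real (card A) * (\<Sum>x\<in>A. g x)" and "1 / real (card A) * (\<Sum>x\<in>A. g x) \<le> b"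
proof -
  have "real (card A) > 0"
    using assms(1,2) by (simp add: card_gt_0_iff)
  moreover have "real (card A) * a \<le> sum g A" "sum g A \<le> real (card A) * b"
    using assms(3,4) by (auto intro: sum_bounded_below sum_bounded_above)
  ultimately show "a \<le> 1 / real (card A) * sum g A" "1 / real (card A) * sum g A \<le> b"
    by (simp_all add: field_simps)
qed

lemma neg_ln_soft_assign:
  assumes "N > 0" and "\<epsilon> > 0"
  shows "- \<epsilon> * ln (soft_assign N \<eta> \<epsilon> \<theta> i x)
    = score \<eta> (\<theta> i) x + \<epsilon> * ln (\<Sum>j\<in>{1..N}. exp (- (1 / \<epsilon>) * score \<eta> (\<theta> j) x))"
proof -
  have "(\<Sum>j\<in>{1..N}. exp (- (1 / \<epsilon>) * score \<eta> (\<theta> j) x)) > 0"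
    using assms(1) by (intro sum_pos) auto
  then have "ln (soft_assign N \<eta> \<epsilon> \<theta> i x)
      = - (1 / \<epsilon>) * score \<eta> (\<theta> i) x - ln (\<Sum>j\<in>{1..N}. exp (- (1 / \<epsilon>) * score \<eta> (\<theta> j) x))"
    unfolding soft_assign_def by (subst ln_div) auto
  then show ?thesis
    using assms(2) by (simp add: right_diff_distrib)
qed

text \<open>In the difference of the two energies the score of the prescribed grain cancels, and the
  average gap between the soft and the hard minimum is left, which can be bounded pixel by pixel.\<close>

lemma energy_minus_limit_energy:
  assumes "N > 0" and "\<epsilon> > 0"
  shows "energy \<Omega> N \<eta> G \<epsilon> \<theta> - limit_energy \<Omega> N \<eta> G \<theta>
    = 1 / real (card \<Omega>) * (\<Sum>x\<in>\<Omega>. (MIN j\<in>{1..N}. score \<eta> (\<theta> j) x)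
        + \<epsilon> * ln (\<Sum>j\<in>{1..N}. exp (- (1 / \<epsilon>) * score \<eta> (\<theta> j) x)))"
proof -
  have "energy \<Omega> N \<eta> G \<epsilon> \<theta>
      = 1 / real (card \<Omega>) * (\<Sum>x\<in>\<Omega>. - \<epsilon> * ln (soft_assign N \<eta> \<epsilon> \<theta> (G x) x))"
    unfolding energy_def objective_def by (simp only: sum_distrib_left[symmetric] mult.left_commute)
  then show ?thesis
    unfolding limit_energy_def neg_ln_soft_assign[OF assms]
    by (simp only: right_diff_distrib[symmetric] sum_subtractf[symmetric])
      (simp add: algebra_simps)
qed

lemma energy_gap_bounds:
  assumes "finite \<Omega>" "\<Omega> \<noteq> {}" "N > 0" "\<epsilon> > 0"
  shows "0 \<le> energy \<Omega> N \<eta> G \<epsilon> \<theta> - limit_energy \<Omega> N \<eta> G \<theta>"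
    and "energy \<Omega> N \<eta> G \<epsilon> \<theta> - limit_energy \<Omega> N \<eta> G \<theta> \<le> \<epsilon> * ln (real N)"
proof -
  have ne: "{1..N} \<noteq> {}"
    using assms(3) by auto
  note gap = log_sum_exp_bounds[OF finite_atLeastAtMost ne assms(4)]
  show "0 \<le> energy \<Omega> N \<eta> G \<epsilon> \<theta> - limit_energy \<Omega> N \<eta> G \<theta>"
    unfolding energy_minus_limit_energy[OF assms(3,4)]
    by (rule average_bounds(1)[OF assms(1,2) gap])
  show "energy \<Omega> N \<eta> G \<epsilon> \<theta> - limit_energy \<Omega> N \<eta> G \<theta> \<le> \<epsilon> * ln (real N)"
    unfolding energy_minus_limit_energy[OF assms(3,4)]
    using average_bounds(2)[OF assms(1,2) gap] by simp
qed

lemma limit_energy_nonneg: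
  assumes "G \<in> \<Omega> \<rightarrow> {1..N}"
  shows "0 \<le> limit_energy \<Omega> N \<eta> G \<theta>"
  unfolding limit_energy_def
  using assms by (intro mult_nonneg_nonneg sum_nonneg) (auto intro!: Min_le)

lemma uniform_limit_energy:
  assumes "finite \<Omega>" "\<Omega> \<noteq> {}" "N > 0"
  shows "uniform_limit X (energy \<Omega> N \<eta> G) (limit_energy \<Omega> N \<eta> G) (at_right 0)"
proof (rule uniform_limitI)
  fix e :: real
  assume "e > 0"
  have "((\<lambda>\<epsilon>. \<epsilon> * ln (real N)) \<longlongrightarrow> 0 * ln (real N)) (at_right 0)"
    by (intro tendsto_intros)
  then have "\<forall>\<^sub>F \<epsilon> in at_right 0. \<epsilon> * ln (real N) < e"
    using \<open>e > 0\<close> by (intro order_tendstoD(2)) simp_all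
  moreover have "\<forall>\<^sub>F \<epsilon> in at_right 0. (0::real) < \<epsilon>"
    by (rule eventually_at_right_less)
  ultimately show "\<forall>\<^sub>F \<epsilon> in at_right 0. \<forall>\<theta>\<in>X.
      dist (energy \<Omega> N \<eta> G \<epsilon> \<theta>) (limit_energy \<Omega> N \<eta> G \<theta>) < e"
  proof eventually_elim
    case (elim \<epsilon>)
    show ?case
    proof
      fix \<theta>
      show "dist (energy \<Omega> N \<eta> G \<epsilon> \<theta>) (limit_energy \<Omega> N \<eta> G \<theta>) < e"
        using energy_gap_bounds[OF assms elim(2), of \<eta> G \<theta>] elim(1) by (simp add: dist_real_def)
    qed
  qed
qed

lemma score_hard_assign:
  assumes "N > 0"
  shows "score \<eta> (\<theta> (hard_assign N \<eta> \<theta> x)) x = (MIN j\<in>{1..N}. score \<eta> (\<theta> j) x)"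
proof -
  let ?P = "is_arg_min (\<lambda>j. score \<eta> (\<theta> j) x) (\<lambda>j. j \<in> {1..N})"
  have "\<exists>i. ?P i"
    using assms by (intro ex_is_arg_min_if_finite[of "{1..N}"]) auto
  then have min: "?P (hard_assign N \<eta> \<theta> x)"
    unfolding hard_assign_def by (rule LeastI_ex)
  show ?thesis
    by (rule Min_eqI[symmetric]) (use min in \<open>auto simp: is_arg_min_linorder\<close>)
qed

lemma limit_energy_perfect_reconstruction:
  assumes "N > 0" and "\<forall>x\<in>\<Omega>. hard_assign N \<eta> \<theta> x = G x"
  shows "limit_energy \<Omega> N \<eta> G \<theta> = 0"
proof -
  have "score \<eta> (\<theta> (G x)) x = (MIN j\<in>{1..N}. score \<eta> (\<theta> j) x)" if "x \<in> \<Omega>" for x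
    using score_hard_assign[OF assms(1), of \<eta> \<theta> x] assms(2) that by simp
  then show ?thesis
    by (simp add: limit_energy_def)
qed

theorem proposition4p7:
  fixes \<Omega> :: "(real \<times> real) set"
    and N :: nat
    and G :: "real \<times> real \<Rightarrow> nat"
    and \<eta> :: "real \<times> real \<Rightarrow> real ^ 'k"
  assumes "finite \<Omega>" and "\<Omega> \<noteq> {}" and "\<Omega> \<subseteq> image_domain"
    and "N > 1"
    and "G \<in> \<Omega> \<rightarrow> {1..N}"
  shows "(\<forall>\<theta>\<in>params N. \<forall>\<epsilon>>0.
            0 \<le> energy \<Omega> N \<eta> G \<epsilon> \<theta> - limit_energy \<Omega> N \<eta> G \<theta> \<and>
            energy \<Omega> N \<eta> G \<epsilon> \<theta> - limit_energy \<Omega> N \<eta> G \<theta> \<le> \<epsilon> * ln (real N))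
       \<and> (\<forall>\<theta>\<in>params N. 0 \<le> limit_energy \<Omega> N \<eta> G \<theta>)
       \<and> uniform_limit (params N) (\<lambda>\<epsilon>. energy \<Omega> N \<eta> G \<epsilon>) (limit_energy \<Omega> N \<eta> G) (at_right 0)
       \<and> ((\<exists>\<theta>\<in>params N. \<forall>x\<in>\<Omega>. hard_assign N \<eta> \<theta> x = G x) \<longrightarrow>
            (\<exists>\<theta>. is_arg_min (limit_energy \<Omega> N \<eta> G) (\<lambda>\<theta>. \<theta> \<in> params N) \<theta> \<and>
                 limit_energy \<Omega> N \<eta> G \<theta> = 0))"
proof -
  have N: "N > 0"
    using assms(4) by simp
  note nonneg = limit_energy_nonneg[OF assms(5), of \<eta>]
  have "\<exists>\<theta>. is_arg_min (limit_energy \<Omega> N \<eta> G) (\<lambda>\<theta>. \<theta> \<in> params N) \<theta> \<and> limit_energy \<Omega> N \<eta> G \<theta> = 0"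
    if "\<exists>\<theta>\<in>params N. \<forall>x\<in>\<Omega>. hard_assign N \<eta> \<theta> x = G x"
  proof -
    from that obtain \<theta> where \<theta>: "\<theta> \<in> params N" "\<forall>x\<in>\<Omega>. hard_assign N \<eta> \<theta> x = G x"
      by blast
    then have "limit_energy \<Omega> N \<eta> G \<theta> = 0"
      using limit_energy_perfect_reconstruction[OF N] by blast
    then show ?thesis
      using \<theta>(1) nonneg by (auto simp: is_arg_min_linorder)
  qed
  then show ?thesis
    using energy_gap_bounds[OF assms(1,2) N] uniform_limit_energy[OF assms(1,2) N] nonneg
    by blast
qed

end
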